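(* Let $H$ be a finite, connected, simple graph with $N$ vertices and maximum degree $\delta\ge 3$. Put $$\nu=\frac{1}{(\delta-1)\ln 16},\qquad a=1+\frac{\sqrt{\pi\delta}}{2^{1-\nu}},\qquad \check t=4^{1+\nu}N^{1-\nu},\qquad \hat t=4^{-\frac{(1+\nu)^2}{\nu}}N^4 .$$ Then for every $t\in[\check t,\hat t]$ the average return probability of the time-continuous regularised random walk $\widehat X_t$ on $H$ satisfies $$\mathbb{P}_{-}[\widehat X_t=\widehat X_0]\;\le\;\frac1N+a\left(\frac{N^{1-\nu}}{\sqrt t}\right)^{\frac{1}{1+\nu}}e^{-4t/(\delta N^2)} .$$
   Context: Let $H=\langle V,E\rangle$ be a finite simple (undirected, loopless, single-edged) graph with $N=|V|$ vertices and maximum degree $\delta$, adjacency matrix $\mathcal A$ and diagonal degree matrix $D$. The regularisation $\widehat H$ is obtained by attaching loops to vertices, each loop increasing the degree of its vertex by one, until every vertex has degree $\delta$. The regularised random walk (RRW) on $H$ is the simple random walk on $\widehat H$; its transition matrix is $A=\delta^{-1}(\mathcal A+\delta I-D)$. The time-continuous RRW $\widehat X_t$ has transition probabilities $\mathbb P^k[\widehat X_t=l]=\big(e^{-t(I-A)}\big)_{kl}$. The average return probability is the return probability under the uniform initial distribution on $V$: $\mathbb P_{-}[\widehat X_t=\widehat X_0]=\frac1N\sum_{k\in V}\mathbb P^k[\widehat X_t=k]=\frac1N\operatorname{Tr}e^{-t(I-A)}$. *)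

theory Defs
  imports "HOL-Analysis.Analysis"
begin

text \<open>
  A finite simple graph is given by its adjacency relation \<open>E\<close> on a finite vertex type;
  the vertex set is the whole type. Each undirected edge is represented by both of its
  orientations.
\<close>

definition simple_graph :: "'v::finite rel \<Rightarrow> bool" where
  "simple_graph E \<longleftrightarrow> sym E \<and> irrefl E"

definition connected_graph :: "'v::finite rel \<Rightarrow> bool" where
  "connected_graph E \<longleftrightarrow> (\<forall>u v. (u, v) \<in> E\<^sup>*)"

definition vertex_degree :: "'v::finite rel \<Rightarrow> 'v \<Rightarrow> nat" where
  "vertex_degree E v = card (E `` {v})"

definition max_degree :: "'v::finite rel \<Rightarrow> nat" where
  "max_degree E = Max (range (vertex_degree E))"

definition adjacency_matrix :: "'v::finite rel \<Rightarrow> real ^ 'v ^ 'v" where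
  "adjacency_matrix E = (\<chi> k l. if (k, l) \<in> E then 1 else 0)"

definition degree_matrix :: "'v::finite rel \<Rightarrow> real ^ 'v ^ 'v" where
  "degree_matrix E = (\<chi> k l. if k = l then real (vertex_degree E k) else 0)"

definition rrw_matrix :: "'v::finite rel \<Rightarrow> real ^ 'v ^ 'v" where
  "rrw_matrix E = (1 / real (max_degree E)) *\<^sub>R
     (adjacency_matrix E + real (max_degree E) *\<^sub>R mat 1 - degree_matrix E)"

lemma degree_le_max_degree: "vertex_degree E v \<le> max_degree E"
  unfolding max_degree_def by (rule Max_ge) auto

text \<open>
  The walk steps along each of the \<open>max_degree E\<close> edges and loops at a vertex with
  equal probability; the vertex \<open>k\<close> carries \<open>max_degree E - vertex_degree E k\<close> loops.
\<close>

lemma rrw_matrix_nth: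
  assumes "simple_graph E"
  shows "rrw_matrix E $ k $ l =
    real (if k = l then max_degree E - vertex_degree E k else if (k, l) \<in> E then 1 else 0)
      / real (max_degree E)"
proof -
  have "(k, k) \<notin> E"
    using assms by (auto simp: simple_graph_def irrefl_def)
  then show ?thesis
    using degree_le_max_degree[of E k]
    by (auto simp: rrw_matrix_def adjacency_matrix_def degree_matrix_def mat_def of_nat_diff)
qed

text \<open>
  The multiplication of the type class on vectors is componentwise, so powers and the
  exponential are defined here with respect to the matrix product \<open>**\<close>.
\<close>

primrec matrix_power :: "real ^ 'n ^ 'n \<Rightarrow> nat \<Rightarrow> real ^ 'n ^ 'n" where
  "matrix_power M 0 = mat 1"
| "matrix_power M (Suc n) = M ** matrix_power M n"

definition matrix_exp :: "real ^ 'n ^ 'n \<Rightarrow> real ^ 'n ^ 'n" where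
  "matrix_exp M = (\<Sum>n. (1 / fact n) *\<^sub>R matrix_power M n)"

lemma summable_matrix_exp:
  fixes M :: "real ^ 'n ^ 'n"
  shows "summable (\<lambda>n. (1 / fact n) *\<^sub>R matrix_power M n)"
proof -
  define c where "c = (\<Sum>i\<in>UNIV. \<Sum>j\<in>UNIV. \<bar>M $ i $ j\<bar>)"
  have row: "(\<Sum>j\<in>UNIV. \<bar>M $ i $ j\<bar>) \<le> c" for i
    unfolding c_def by (rule member_le_sum) (auto intro: sum_nonneg)
  have c0: "0 \<le> c"
    unfolding c_def by (intro sum_nonneg) auto
  have bound: "\<bar>matrix_power M n $ i $ j\<bar> \<le> c ^ n" for n i j
  proof (induction n arbitrary: i j)
    case 0
    show ?case by (simp add: mat_def)
  next
    case (Suc n)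
    have "\<bar>matrix_power M (Suc n) $ i $ j\<bar> \<le> (\<Sum>k\<in>UNIV. \<bar>M $ i $ k\<bar> * \<bar>matrix_power M n $ k $ j\<bar>)"
      by (simp add: matrix_matrix_mult_def flip: abs_mult)
    also have "\<dots> \<le> (\<Sum>k\<in>UNIV. \<bar>M $ i $ k\<bar> * c ^ n)"
      by (intro sum_mono mult_left_mono Suc) auto
    also have "\<dots> = (\<Sum>k\<in>UNIV. \<bar>M $ i $ k\<bar>) * c ^ n"
      by (simp add: sum_distrib_right)
    also have "\<dots> \<le> c * c ^ n"
      by (intro mult_right_mono row) (simp add: c0)
    finally show ?case by simp
  qed
  have "norm (matrix_power M n) \<le> real (CARD('n) * CARD('n)) * c ^ n" for n
  proof -
    have "norm (matrix_power M n) \<le> (\<Sum>i\<in>UNIV. norm (matrix_power M n $ i))"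
      by (simp add: norm_vec_def L2_set_le_sum)
    also have "\<dots> \<le> (\<Sum>i\<in>UNIV. \<Sum>j\<in>UNIV. \<bar>matrix_power M n $ i $ j\<bar>)"
      by (intro sum_mono norm_le_l1_cart)
    also have "\<dots> \<le> (\<Sum>i\<in>(UNIV::'n set). \<Sum>j\<in>(UNIV::'n set). c ^ n)"
      by (intro sum_mono bound)
    finally show ?thesis by simp
  qed
  then have bnd: "norm ((1 / fact n) *\<^sub>R matrix_power M n)
      \<le> real (CARD('n) * CARD('n)) * (c ^ n /\<^sub>R fact n)" for n
    by (simp add: field_simps)
  have "summable (\<lambda>n. real (CARD('n) * CARD('n)) * (c ^ n /\<^sub>R fact n))"
    by (intro summable_mult summable_exp_generic)
  then show ?thesis
    by (rule summable_comparison_test'[where N = 0]) (rule bnd)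
qed

text \<open>
  The law of the time-continuous walk at time \<open>t\<close> when started from \<open>k\<close>, evaluated at \<open>l\<close>.
\<close>

definition rrw_prob :: "'v::finite rel \<Rightarrow> real \<Rightarrow> 'v \<Rightarrow> 'v \<Rightarrow> real" where
  "rrw_prob E t k l = matrix_exp (- t *\<^sub>R (mat 1 - rrw_matrix E)) $ k $ l"

definition average_return_prob :: "'v::finite rel \<Rightarrow> real \<Rightarrow> real" where
  "average_return_prob E t = (1 / real CARD('v)) * (\<Sum>k\<in>UNIV. rrw_prob E t k k)"

end

theory Submission
  imports Defs
begin

text \<open>
  With \<open>c\<^sub>j\<close> the eigenvalues of the Laplacian \<open>D - A\<close>, the average return probability is the mean of
  \<open>exp (- t * c\<^sub>j / \<delta>)\<close>. Cauchy--Schwarz along a geodesic bounds the effective resistance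
  between \<open>x\<close> and \<open>y\<close>, which is the sum of \<open>(u\<^sub>j y - u\<^sub>j x)\<^sup>2 / c\<^sub>j\<close> over an orthonormal
  eigenbasis \<open>u\<^sub>j\<close>, by the graph distance. Summing over all pairs, and using that the distances from
  a fixed vertex fill an initial segment of the naturals, the sum of the \<open>1 / c\<^sub>j\<close> over the positive
  eigenvalues is at most \<open>N\<^sup>2 / 4\<close>. This gives the gap \<open>c\<^sub>j \<ge> 4 / N\<^sup>2\<close> and, at the same time,
  enough growth of the \<open>c\<^sub>j\<close>: the exponential sum over positive eigenvalues is at most
  \<open>exp (- 4 * t / (\<delta> * N\<^sup>2))\<close> times both \<open>N\<close> and \<open>max 1 (\<delta> * N\<^sup>2 / (4 * t))\<close>.
  On the given time interval one of these two factors is at most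
  \<open>N * (N powr (1 - \<nu>) / sqrt t) powr (1 / (1 + \<nu>))\<close>.
\<close>

section \<open>Spectral decomposition of symmetric matrices\<close>

text \<open>A maximiser of \<open>x \<bullet> f x\<close> on the unit sphere of \<open>S\<close>,
  which exists by compactness, is an eigenvector. The vector \<open>w\<close> makes that sphere
  nonempty; the invariant subspace \<open>S\<close> lets eigenvectors be split off one by
  one.\<close>

lemma self_adjoint_eigenvector:
  fixes f :: "'a::euclidean_space \<Rightarrow> 'a"
  assumes f: "linear f" and adj: "\<And>x y. f x \<bullet> y = x \<bullet> f y"
    and S: "subspace S" and inv: "\<And>x. x \<in> S \<Longrightarrow> f x \<in> S" and w: "w \<in> S" "w \<noteq> 0"
  obtains v c where "v \<in> S" "norm v = 1" "f v = c *\<^sub>R v"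
proof -
  define K where "K = S \<inter> sphere 0 1"
  have "compact K"
    unfolding K_def using closed_subspace[OF S] by (simp add: closed_Int_compact)
  moreover have "(1 / norm w) *\<^sub>R w \<in> K"
    using w S by (simp add: K_def subspace_scale)
  moreover have "continuous_on K (\<lambda>x. x \<bullet> f x)"
    using f by (intro continuous_intros linear_continuous_on) (simp add: linear_conv_bounded_linear)
  ultimately obtain v where v: "v \<in> K" and max: "\<And>y. y \<in> K \<Longrightarrow> y \<bullet> f y \<le> v \<bullet> f v"
    using continuous_attains_sup[of K "\<lambda>x. x \<bullet> f x"] by blast
  define c where "c = v \<bullet> f v"
  have vS: "v \<in> S" and v1: "norm v = 1"
    using v by (auto simp: K_def)
  have form_nonneg: "0 \<le> c * (z \<bullet> z) - z \<bullet> f z" if "z \<in> S" for z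
  proof (cases "z = 0")
    case False
    have "(1 / norm z) *\<^sub>R z \<in> K"
      using False that S by (simp add: K_def subspace_scale)
    from max[OF this] have "(z \<bullet> f z) / (norm z)\<^sup>2 \<le> c"
      by (simp add: c_def linear_scale[OF f] power2_eq_square)
    then show ?thesis
      using False by (simp add: field_simps power2_norm_eq_inner)
  qed (simp add: linear_0[OF f])
  define g where "g = c *\<^sub>R v - f v"
  have gS: "g \<in> S"
    unfolding g_def using vS S inv by (simp add: subspace_diff subspace_scale)
  \<comment> \<open>A null vector of the positive semidefinite form \<open>c * (z \<bullet> z) - z \<bullet> f z\<close> lies in its radical.\<close>
  have "g \<bullet> g = 0"
  proof (rule ccontr)
    assume "g \<bullet> g \<noteq> 0"
    then have gpos: "g \<bullet> g > 0"
      by simp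
    define q where "q = c * (g \<bullet> g) - g \<bullet> f g"
    have expand: "c * ((v + e *\<^sub>R g) \<bullet> (v + e *\<^sub>R g)) - (v + e *\<^sub>R g) \<bullet> f (v + e *\<^sub>R g)
        = 2 * e * (g \<bullet> g) + e\<^sup>2 * q" for e
    proof -
      have "v \<bullet> v = 1" "v \<bullet> f v = c" "f v \<bullet> v = c" "v \<bullet> f g = f v \<bullet> g"
        using v1 adj by (simp_all add: c_def norm_eq_1 inner_commute)
      then show ?thesis
        by (simp add: linear_add[OF f] linear_scale[OF f] q_def inner_add_left inner_add_right
            algebra_simps power2_eq_square inner_commute[of g "f v"] inner_commute[of g v])
          (simp add: g_def inner_diff_left inner_diff_right algebra_simps inner_commute)
    qed
    have nn: "0 \<le> 2 * e * (g \<bullet> g) + e\<^sup>2 * q" for e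
      unfolding expand[symmetric] using form_nonneg[of "v + e *\<^sub>R g"] vS gS S
      by (simp add: subspace_add subspace_scale)
    have q0: "0 \<le> q"
      using form_nonneg[OF gS] by (simp add: q_def)
    \<comment> \<open>The form is evaluated at \<open>v\<close> displaced along \<open>g\<close> by
      \<open>- (g \<bullet> g) * r\<close>. As \<open>r * q < 1\<close>, the negative linear term
      outweighs the quadratic one; the summand 1 covers \<open>q = 0\<close>.\<close>
    define r where "r = 1 / (q + 1)"
    have "r > 0" "r * q < 1"
      using q0 by (simp_all add: r_def)
    then have "(g \<bullet> g)\<^sup>2 * r * (r * q - 2) < 0"
      using gpos by (intro mult_pos_neg) auto
    moreover have "2 * (- (g \<bullet> g) * r) * (g \<bullet> g) + (- (g \<bullet> g) * r)\<^sup>2 * q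
        = (g \<bullet> g)\<^sup>2 * r * (r * q - 2)"
      by (simp add: power2_eq_square algebra_simps)
    ultimately show False
      using nn[of "- (g \<bullet> g) * r"] by linarith
  qed
  then have "f v = c *\<^sub>R v"
    by (simp add: g_def)
  with vS v1 show ?thesis
    by (rule that)
qed

text \<open>By self-adjointness the orthogonal complement of the eigenvectors found so far is
  invariant. It is nonzero while there are fewer than \<open>DIM('a)\<close> of them, so it contains
  the next one.\<close>

lemma self_adjoint_orthonormal_eigenvectors:
  fixes f :: "'a::euclidean_space \<Rightarrow> 'a"
  assumes f: "linear f" and adj: "\<And>x y. f x \<bullet> y = x \<bullet> f y" and "k \<le> DIM('a)"
  shows "\<exists>B. finite B \<and> card B = k \<and> pairwise orthogonal B
    \<and> (\<forall>b\<in>B. norm b = 1 \<and> (\<exists>c. f b = c *\<^sub>R b))"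
  using \<open>k \<le> DIM('a)\<close>
proof (induction k)
  case 0
  show ?case
    by (rule exI[of _ "{}"]) simp
next
  case (Suc k)
  then obtain B where B: "finite B" "card B = k" "pairwise orthogonal B"
    and eig: "\<And>b. b \<in> B \<Longrightarrow> norm b = 1 \<and> (\<exists>c. f b = c *\<^sub>R b)"
    by auto
  define S where "S = {x. \<forall>b\<in>B. b \<bullet> x = 0}"
  have S: "subspace S"
    unfolding S_def by (auto simp: subspace_def inner_add_right)
  have inv: "f x \<in> S" if "x \<in> S" for x
  proof -
    have "b \<bullet> f x = 0" if "b \<in> B" for b
    proof -
      obtain c where "f b = c *\<^sub>R b"
        using eig \<open>b \<in> B\<close> by blast
      then have "b \<bullet> f x = c * (b \<bullet> x)"
        by (simp flip: adj)
      then show ?thesis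
        using \<open>x \<in> S\<close> \<open>b \<in> B\<close> by (simp add: S_def)
    qed
    then show ?thesis
      by (simp add: S_def)
  qed
  have "dim B < DIM('a)"
    using dim_le_card'[OF B(1)] B(2) Suc.prems by simp
  then obtain w where "w \<noteq> 0" "\<And>y. y \<in> span B \<Longrightarrow> orthogonal w y"
    using orthogonal_to_subspace_exists by blast
  then have "w \<in> S"
    by (simp add: S_def orthogonal_def span_base inner_commute)
  then obtain v c where v: "v \<in> S" "norm v = 1" "f v = c *\<^sub>R v"
    using self_adjoint_eigenvector[OF f adj S inv] \<open>w \<noteq> 0\<close> by blast
  have "v \<notin> B"
    using v by (auto simp: S_def norm_eq_1)
  moreover have "pairwise orthogonal (insert v B)"
    using B(3) v(1) by (auto simp: pairwise_insert orthogonal_def S_def inner_commute)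
  ultimately show ?case
    using B eig v by (intro exI[of _ "insert v B"]) auto
qed

lemma symmetric_matrix_orthonormal_eigenbasis:
  fixes M :: "real ^ 'n ^ 'n"
  assumes "transpose M = M"
  obtains u :: "'n \<Rightarrow> real ^ 'n" and c :: "'n \<Rightarrow> real"
  where "\<And>i j. u i \<bullet> u j = (if i = j then 1 else 0)" and "\<And>i. M *v u i = c i *\<^sub>R u i"
proof -
  have "\<exists>B. finite B \<and> card B = CARD('n) \<and> pairwise orthogonal B
    \<and> (\<forall>b\<in>B. norm b = 1 \<and> (\<exists>c. M *v b = c *\<^sub>R b))"
  proof (rule self_adjoint_orthonormal_eigenvectors)
    show "(M *v x) \<bullet> y = x \<bullet> (M *v y)" for x y
      using dot_lmul_matrix[of x M y] vector_transpose_matrix[of x M, unfolded assms] by simp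
  qed (simp_all add: matrix_vector_mul_linear)
  then obtain B where B: "finite B" "card B = CARD('n)" "pairwise orthogonal B"
    and eig: "\<And>b. b \<in> B \<Longrightarrow> norm b = 1 \<and> (\<exists>c. M *v b = c *\<^sub>R b)"
    by blast
  obtain u where u: "bij_betw u (UNIV :: 'n set) B"
    using finite_same_card_bij[of "UNIV :: 'n set" B] B by auto
  then have uB: "u i \<in> B" for i
    by (auto simp: bij_betw_def)
  have "\<forall>i. \<exists>c. M *v u i = c *\<^sub>R u i"
    using eig[OF uB] by simp
  from choice[OF this] obtain c where "\<And>i. M *v u i = c i *\<^sub>R u i"
    by auto
  moreover have "u i \<bullet> u j = (if i = j then 1 else 0)" for i j
  proof (cases "i = j")
    case True
    then show ?thesis
      using eig[OF uB[of i], THEN conjunct1] by (simp add: norm_eq_1)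
  next
    case False
    then have "u i \<noteq> u j"
      using u by (simp add: bij_betw_def inj_eq)
    then have "orthogonal (u i) (u j)"
      using pairwiseD[OF B(3) uB uB] by blast
    then show ?thesis
      using False by (simp add: orthogonal_def)
  qed
  ultimately show ?thesis
    by (intro that[of u c]) auto
qed

text \<open>The matrix \<open>U\<close> with rows \<open>u i\<close> is orthogonal, so cyclicity
  gives \<open>M\<close> the same trace as \<open>U ** (M ** transpose U)\<close>, whose diagonal
  entries are the summands.\<close>

lemma trace_orthonormal_basis:
  fixes M :: "real ^ 'n ^ 'n" and u :: "'n \<Rightarrow> real ^ 'n"
  assumes u: "\<And>i j. u i \<bullet> u j = (if i = j then 1 else 0)"
  shows "trace M = (\<Sum>i\<in>UNIV. u i \<bullet> (M *v u i))"
proof -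
  define U :: "real ^ 'n ^ 'n" where "U = (\<chi> i. u i)"
  have "U ** transpose U = mat 1"
    using u by (simp add: U_def vec_eq_iff matrix_matrix_mult_def transpose_def mat_def inner_vec_def)
  then have "transpose U ** U = mat 1"
    using matrix_left_right_inverse by blast
  then have "trace M = trace ((M ** transpose U) ** U)"
    by (simp add: matrix_mul_rid flip: matrix_mul_assoc)
  also have "\<dots> = trace (U ** (M ** transpose U))"
    by (rule trace_mul_sym)
  also have "\<dots> = (\<Sum>i\<in>UNIV. u i \<bullet> (M *v u i))"
    by (simp add: trace_def U_def matrix_matrix_mult_def transpose_def inner_vec_def
        matrix_vector_mult_def)
  finally show ?thesis .
qed

section \<open>Matrix powers and exponentials on eigenvectors\<close>

lemma matrix_power_eigenvector:
  assumes "M *v x = c *\<^sub>R x"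
  shows "matrix_power M n *v x = c ^ n *\<^sub>R x"
  by (induction n)
    (simp_all add: assms matrix_vector_mult_scaleR mult.commute flip: matrix_vector_mul_assoc)

lemma matrix_exp_eigenvector:
  fixes M :: "real ^ 'n ^ 'n"
  assumes "M *v x = c *\<^sub>R x"
  shows "matrix_exp M *v x = exp c *\<^sub>R x"
proof -
  have lin: "bounded_linear (\<lambda>A :: real ^ 'n ^ 'n. A *v x)"
    by (rule linear_conv_bounded_linear[THEN iffD1])
      (simp add: linear_iff matrix_vector_mult_add_rdistrib scaleR_matrix_vector_assoc)
  have "(\<lambda>n. (1 / fact n) *\<^sub>R matrix_power M n) sums matrix_exp M"
    unfolding matrix_exp_def by (rule summable_sums[OF summable_matrix_exp])
  from bounded_linear.sums[OF lin this]
  have "(\<lambda>n. (c ^ n /\<^sub>R fact n) *\<^sub>R x) sums (matrix_exp M *v x)"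
    by (simp add: matrix_power_eigenvector[OF assms] divide_inverse
        flip: scaleR_matrix_vector_assoc)
  moreover have "(\<lambda>n. (c ^ n /\<^sub>R fact n) *\<^sub>R x) sums (exp c *\<^sub>R x)"
    by (intro bounded_linear.sums[OF bounded_linear_scaleR_left] exp_converges)
  ultimately show ?thesis
    by (rule sums_unique2)
qed

section \<open>Geodesics and the Dirichlet energy\<close>

text \<open>If no walk joins \<open>x\<close> to \<open>y\<close>, the \<open>LEAST\<close> carries
  no information; connectedness supplies a walk wherever the distance is attained below.\<close>

definition graph_dist :: "'v::finite rel \<Rightarrow> 'v \<Rightarrow> 'v \<Rightarrow> nat" where
  "graph_dist E x y = (LEAST n. (x, y) \<in> E ^^ n)"

lemma graph_dist_le: "(x, y) \<in> E ^^ n \<Longrightarrow> graph_dist E x y \<le> n"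
  unfolding graph_dist_def by (rule Least_le)

lemma relpow_graph_dist: "connected_graph E \<Longrightarrow> (x, y) \<in> E ^^ graph_dist E x y"
  unfolding graph_dist_def connected_graph_def by (metis LeastI rtrancl_power)

lemma graph_dist_SucE:
  assumes "connected_graph E" and "graph_dist E x y = Suc n"
  obtains w where "(w, y) \<in> E" and "graph_dist E x w = n"
proof -
  obtain w where w: "(x, w) \<in> E ^^ n" "(w, y) \<in> E"
    using relpow_graph_dist[OF assms(1), of x y] assms(2) by (metis relpow_Suc_E)
  have "Suc n \<le> Suc (graph_dist E x w)"
    using graph_dist_le relpow_Suc_I[OF relpow_graph_dist[OF assms(1)] w(2)] assms(2) by metis
  then have "graph_dist E x w = n"
    using graph_dist_le[OF w(1)] by simp
  with w(2) show ?thesis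
    by (rule that)
qed

text \<open>The clause on \<open>graph_dist E x (w i)\<close> serves twice: it makes the vertices of
  the path distinct, and it shows that the distances from \<open>x\<close> fill an initial
  segment.\<close>

lemma geodesic:
  assumes "connected_graph E"
  shows "\<exists>w. w 0 = x \<and> w (graph_dist E x y) = y \<and> (\<forall>i\<le>graph_dist E x y. graph_dist E x (w i) = i)
    \<and> (\<forall>i<graph_dist E x y. (w i, w (Suc i)) \<in> E)"
proof (induction "graph_dist E x y" arbitrary: y)
  case 0
  then have "x = y"
    using relpow_graph_dist[OF assms, of x y] by simp
  then show ?case
    using 0 by (intro exI[of _ "\<lambda>_. x"]) simp
next
  case (Suc n)
  then obtain z where z: "(z, y) \<in> E" "graph_dist E x z = n"
    using graph_dist_SucE[OF assms] by metis
  with Suc(1)[of z] obtain w where w: "w 0 = x" "w n = z" "\<forall>i\<le>n. graph_dist E x (w i) = i"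
      "\<forall>i<n. (w i, w (Suc i)) \<in> E"
    by auto
  show ?case
    unfolding Suc(2)[symmetric]
    by (intro exI[of _ "w(Suc n := y)"]) (use w z Suc(2)[symmetric] in \<open>auto simp: le_Suc_eq less_Suc_eq\<close>)
qed

text \<open>Remove a point \<open>y\<close> with the largest value: all of \<open>{..d y}\<close> is
  attained on \<open>A\<close>, so \<open>d y \<le> card A - 1\<close>, and induction bounds the
  rest.\<close>

lemma sum_le_of_downward_closed_image:
  fixes d :: "'a \<Rightarrow> nat"
  assumes "finite A" and "\<And>n y. y \<in> A \<Longrightarrow> n \<le> d y \<Longrightarrow> n \<in> d ` A"
  shows "(\<Sum>y\<in>A. d y) \<le> (\<Sum>k<card A. k)"
  using assms
proof (induction "card A" arbitrary: A)
  case 0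
  then show ?case by simp
next
  case (Suc m)
  then have "A \<noteq> {}"
    by auto
  then obtain y where y: "y \<in> A" "\<And>z. z \<in> A \<Longrightarrow> d z \<le> d y"
    using Suc.prems(1) Max_in[of "d ` A"] Max_ge[of "d ` A"] by fastforce
  have card: "card (A - {y}) = m"
    using Suc.hyps(2) y Suc.prems(1) by simp
  have "{..d y} \<subseteq> d ` A"
    using Suc.prems(2) y(1) by auto
  then have "card {..d y} \<le> card A"
    using Suc.prems(1) by (metis card_image_le card_mono finite_imageI le_trans)
  then have "d y \<le> m"
    using Suc.hyps(2) by simp
  moreover have "(\<Sum>z\<in>A - {y}. d z) \<le> (\<Sum>k<m. k)"
  proof -
    \<comment> \<open>Downward closure survives the removal: if the witness for \<open>n\<close> is
      \<open>y\<close> itself, then \<open>n = d y \<ge> d z \<ge> n\<close>, and \<open>z\<close>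
      replaces it.\<close>
    have "n \<in> d ` (A - {y})" if z: "z \<in> A - {y}" "n \<le> d z" for n z
    proof -
      obtain v where v: "v \<in> A" "n = d v"
        using Suc.prems(2)[of z n] z by auto
      show ?thesis
      proof (cases "v = y")
        case True
        then have "d z = n"
          using z v y(2)[of z] by simp
        then show ?thesis
          using z by auto
      qed (use v in auto)
    qed
    then show ?thesis
      using Suc.hyps(1)[of "A - {y}"] card Suc.prems(1) by auto
  qed
  ultimately show ?case
    using Suc.hyps(2) Suc.prems(1) y(1) by (simp add: sum.remove[of A y] flip: Suc.hyps(2))
qed

text \<open>The extremal case is a path with \<open>x\<close> as an endpoint, where the distances
  are 0, 1, ..., N - 1.\<close>

lemma sum_graph_dist_le:
  fixes E :: "'v::finite rel"
  assumes "connected_graph E"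
  shows "2 * (\<Sum>y\<in>UNIV. graph_dist E x y) \<le> CARD('v) * (CARD('v) - 1)"
proof -
  have "n \<in> range (graph_dist E x)" if "n \<le> graph_dist E x y" for n y
    using geodesic[OF assms, of x y] that by (metis rangeI)
  then have "(\<Sum>y\<in>UNIV. graph_dist E x y) \<le> (\<Sum>k<CARD('v). k)"
    by (intro sum_le_of_downward_closed_image) auto
  moreover have "2 * (\<Sum>k<n. k) = n * (n - 1)" for n :: nat
  proof (induction n)
    case (Suc n)
    then show ?case
      by (cases n) auto
  qed simp
  ultimately show ?thesis
    by (metis mult_le_mono2)
qed

section \<open>Dirichlet energy and the graph Laplacian\<close>

text \<open>Both orientations of an edge lie in \<open>E\<close>; halving counts each undirected
  edge once.\<close>

definition dirichlet_energy :: "'v::finite rel \<Rightarrow> real ^ 'v \<Rightarrow> real" where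
  "dirichlet_energy E g = (\<Sum>(k, l)\<in>E. (g $ k - g $ l)\<^sup>2) / 2"

lemma dirichlet_energy_nonneg: "0 \<le> dirichlet_energy E g"
  unfolding dirichlet_energy_def by (intro divide_nonneg_nonneg sum_nonneg) auto

text \<open>Telescope \<open>g\<close> along a geodesic and apply Cauchy-Schwarz to its increments.
  The edges of a geodesic are distinct, so the squared increments sum to at most the energy.\<close>

lemma difference_sq_le_energy:
  assumes E: "simple_graph E" "connected_graph E"
  shows "(g $ y - g $ x)\<^sup>2 \<le> real (graph_dist E x y) * dirichlet_energy E g"
proof -
  define n where "n = graph_dist E x y"
  obtain w where w: "w 0 = x" "w n = y" "\<And>i. i \<le> n \<Longrightarrow> graph_dist E x (w i) = i"
      "\<And>i. i < n \<Longrightarrow> (w i, w (Suc i)) \<in> E"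
    using geodesic[OF E(2), of x y] unfolding n_def by blast
  \<comment> \<open>\<open>p\<close> and \<open>q\<close> list the edges of the geodesic in the two
    orientations. Having both inside \<open>E\<close> compensates for the factor 1/2 in the
    energy.\<close>
  define p where "p = (\<lambda>i. (w i, w (Suc i)))"
  define q where "q = (\<lambda>i. (w (Suc i), w i))"
  define h where "h = (\<lambda>(k, l). (g $ k - g $ l)\<^sup>2)"
  have w_inj: "w i = w j \<longleftrightarrow> i = j" if "i \<le> n" "j \<le> n" for i j
    using w(3) that by metis
  have inj: "inj_on p {..<n}" "inj_on q {..<n}"
    by (auto simp: p_def q_def inj_on_def w_inj)
  have disj: "p ` {..<n} \<inter> q ` {..<n} = {}"
    by (auto simp: p_def q_def w_inj)
  have sub: "p ` {..<n} \<union> q ` {..<n} \<subseteq> E"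
    using w(4) E(1) by (auto simp: p_def q_def simple_graph_def dest: symD)
  have "2 * (\<Sum>i<n. h (p i)) = (\<Sum>i<n. h (p i)) + (\<Sum>i<n. h (q i))"
    by (simp add: p_def q_def h_def power2_commute)
  also have "\<dots> = sum h (p ` {..<n} \<union> q ` {..<n})"
    using inj disj by (simp add: sum.union_disjoint sum.reindex del: Un_insert_left)
  also have "\<dots> \<le> sum h E"
    by (intro sum_mono2 sub) (auto simp: h_def)
  finally have energy: "(\<Sum>i<n. h (p i)) \<le> dirichlet_energy E g"
    by (simp add: dirichlet_energy_def h_def)
  have "g $ y - g $ x = (\<Sum>i<n. g $ w (Suc i) - g $ w i)"
    using sum_lessThan_telescope[of "\<lambda>i. g $ w i" n] w(1,2) by simp
  then have "(g $ y - g $ x)\<^sup>2 \<le> (\<Sum>i<n. (g $ w (Suc i) - g $ w i)\<^sup>2) * real n"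
    using sum_squared_le_sum_of_squares[of "\<lambda>i. g $ w (Suc i) - g $ w i" "{..<n}"] by simp
  also have "\<dots> = (\<Sum>i<n. h (p i)) * real n"
    by (simp add: h_def p_def power2_commute)
  also have "\<dots> \<le> dirichlet_energy E g * real n"
    by (intro mult_right_mono energy) simp
  finally show ?thesis
    by (simp add: n_def mult.commute)
qed

definition laplacian :: "'v::finite rel \<Rightarrow> real ^ 'v ^ 'v" where
  "laplacian E = degree_matrix E - adjacency_matrix E"

lemma transpose_laplacian: "simple_graph E \<Longrightarrow> transpose (laplacian E) = laplacian E"
  by (auto simp: laplacian_def transpose_def vec_eq_iff degree_matrix_def adjacency_matrix_def
      simple_graph_def dest: symD)

lemma laplacian_mult_nth: "(laplacian E *v g) $ k = (\<Sum>l\<in>E `` {k}. g $ k - g $ l)"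
proof -
  have "(laplacian E *v g) $ k
      = (\<Sum>l\<in>UNIV. if k = l then real (vertex_degree E k) * g $ l else 0)
        - (\<Sum>l\<in>UNIV. if l \<in> E `` {k} then g $ l else 0)"
    by (simp add: laplacian_def matrix_vector_mult_def degree_matrix_def adjacency_matrix_def
        left_diff_distrib sum_subtractf if_distrib[of "\<lambda>c. c * _"] cong: if_cong)
  also have "\<dots> = real (card (E `` {k})) * g $ k - (\<Sum>l\<in>E `` {k}. g $ l)"
    by (simp add: vertex_degree_def sum.If_cases Image_singleton)
  finally show ?thesis
    by (simp add: sum_subtractf)
qed

text \<open>Summation by parts: reversing all edges turns \<open>g $ k * (g $ k - g $ l)\<close>
  into \<open>g $ l * (g $ l - g $ k)\<close>, and the two add up to a square.\<close>

lemma inner_laplacian: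
  assumes "simple_graph E"
  shows "g \<bullet> (laplacian E *v g) = dirichlet_energy E g"
proof -
  have "g \<bullet> (laplacian E *v g) = (\<Sum>k\<in>UNIV. \<Sum>l\<in>E `` {k}. g $ k * (g $ k - g $ l))"
    by (simp add: inner_vec_def laplacian_mult_nth sum_distrib_left)
  also have "\<dots> = (\<Sum>(k, l)\<in>Sigma UNIV (\<lambda>k. E `` {k}). g $ k * (g $ k - g $ l))"
    by (rule sum.Sigma) auto
  also have "Sigma UNIV (\<lambda>k. E `` {k}) = E"
    by auto
  finally have 1: "g \<bullet> (laplacian E *v g) = (\<Sum>(k, l)\<in>E. g $ k * (g $ k - g $ l))" .
  also have "\<dots> = (\<Sum>(k, l)\<in>E. g $ l * (g $ l - g $ k))"
    using assms by (intro sum.reindex_bij_witness[of _ prod.swap prod.swap])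
      (auto simp: simple_graph_def dest: symD)
  finally have "2 * (g \<bullet> (laplacian E *v g))
      = (\<Sum>(k, l)\<in>E. g $ k * (g $ k - g $ l)) + (\<Sum>(k, l)\<in>E. g $ l * (g $ l - g $ k))"
    using 1 by simp
  also have "\<dots> = (\<Sum>(k, l)\<in>E. (g $ k - g $ l)\<^sup>2)"
    by (auto simp: power2_eq_square algebra_simps intro!: sum.cong simp flip: sum.distrib)
  finally show ?thesis
    by (simp add: dirichlet_energy_def)
qed

section \<open>Effective resistance and the Laplacian spectrum\<close>

text \<open>Over ordered pairs the effective resistances sum to \<open>2 * N\<close> times the
  left-hand side, while the distances dominating them sum to at most
  \<open>N ^ 3 / 2\<close>.\<close>

lemma sum_inverse_eigenvalues_le:
  fixes E :: "'v::finite rel" and u :: "'v \<Rightarrow> real ^ 'v"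
  assumes E: "simple_graph E" "connected_graph E"
    and u: "\<And>i j. u i \<bullet> u j = (if i = j then 1 else 0)"
    and eig: "\<And>i. laplacian E *v u i = c i *\<^sub>R u i"
  shows "(\<Sum>j | 0 < c j. 1 / c j) \<le> (real CARD('v))\<^sup>2 / 4"
proof -
  define P where "P = {j. 0 < c j}"
  define N where "N = real CARD('v)"
  have N: "N > 0"
    by (simp add: N_def)
  have effective_resistance_le: "(\<Sum>j\<in>P. (u j $ y - u j $ x)\<^sup>2 / c j) \<le> real (graph_dist E x y)" for x y
  proof -
    define T where "T = (\<Sum>j\<in>P. (u j $ y - u j $ x)\<^sup>2 / c j)"
    \<comment> \<open>The potential of the unit current flow between \<open>x\<close> and \<open>y\<close>.\<close>
    define g where "g = (\<Sum>j\<in>P. ((u j $ y - u j $ x) / c j) *\<^sub>R u j)"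
    have "g $ y - g $ x = (\<Sum>j\<in>P. (u j $ y - u j $ x) / c j * u j $ y)
        - (\<Sum>j\<in>P. (u j $ y - u j $ x) / c j * u j $ x)"
      by (simp add: g_def)
    also have "\<dots> = T"
      unfolding T_def sum_subtractf[symmetric] right_diff_distrib[symmetric]
      by (simp add: power2_eq_square)
    finally have "g $ y - g $ x = T" .
    have Lg: "laplacian E *v g = (\<Sum>j\<in>P. (u j $ y - u j $ x) *\<^sub>R u j)"
      unfolding g_def linear_sum[OF matrix_vector_mul_linear]
      by (intro sum.cong) (auto simp: P_def eig matrix_vector_mult_scaleR)
    \<comment> \<open>\<open>T\<close> is both the potential difference and the energy of
      \<open>g\<close>, so the geodesic bound becomes
      \<open>T * T \<le> real (graph_dist E x y) * T\<close>, and \<open>T\<close> cancels.\<close>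
    have "dirichlet_energy E g = T"
      unfolding inner_laplacian[OF E(1), symmetric] Lg
      by (simp add: g_def T_def inner_sum_left inner_sum_right u if_distrib[of "\<lambda>c. _ * c"]
          power2_eq_square cong: if_cong)
    with \<open>g $ y - g $ x = T\<close> have "T * T \<le> real (graph_dist E x y) * T"
      using difference_sq_le_energy[OF E, of g y x] by (simp add: power2_eq_square)
    moreover have "0 \<le> T"
      using \<open>dirichlet_energy E g = T\<close> dirichlet_energy_nonneg by metis
    ultimately have "T \<le> real (graph_dist E x y)"
      by (cases "T = 0") (auto simp: mult_le_cancel_right)
    then show ?thesis
      by (simp add: T_def)
  qed
  \<comment> \<open>The all-ones vector \<open>1\<close> lies in the kernel of the symmetric
    Laplacian, so it is orthogonal to every eigenvector of positive eigenvalue.\<close>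
  have zero_sum: "(\<Sum>k\<in>UNIV. u j $ k) = 0" if "j \<in> P" for j
  proof -
    have "c j * (\<Sum>k\<in>UNIV. u j $ k) = (\<Sum>k\<in>UNIV. (laplacian E *v u j) $ k)"
      by (simp add: eig sum_distrib_left)
    also have "\<dots> = 1 \<bullet> (laplacian E *v u j)"
      by (simp add: inner_vec_def)
    also have "\<dots> = (1 v* laplacian E) \<bullet> u j"
      by (simp add: dot_lmul_matrix)
    also have "1 v* laplacian E = laplacian E *v 1"
      using vector_transpose_matrix[of 1 "laplacian E"] by (simp add: transpose_laplacian[OF E(1)])
    also have "laplacian E *v 1 = 0"
      by (simp add: vec_eq_iff laplacian_mult_nth)
    finally show ?thesis
      using that by (simp add: P_def)
  qed
  have pair_sum: "(\<Sum>x\<in>UNIV. \<Sum>y\<in>UNIV. (u j $ y - u j $ x)\<^sup>2) = 2 * N" if "j \<in> P" for j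
  proof -
    have norm: "(\<Sum>y\<in>UNIV. (u j $ y)\<^sup>2) = 1"
      using u[of j j] by (simp add: inner_vec_def power2_eq_square)
    have "(\<Sum>y\<in>UNIV. (u j $ y - u j $ x)\<^sup>2) = 1 + N * (u j $ x)\<^sup>2" for x
      using zero_sum[OF that] norm
      by (simp add: power2_diff sum.distrib sum_subtractf N_def flip: sum_distrib_left sum_distrib_right)
    then show ?thesis
      using norm by (simp add: sum.distrib N_def flip: sum_distrib_left)
  qed
  have "(\<Sum>j\<in>P. 1 / c j) * (2 * N) = (\<Sum>j\<in>P. \<Sum>x\<in>UNIV. \<Sum>y\<in>UNIV. (u j $ y - u j $ x)\<^sup>2 / c j)"
    by (simp add: pair_sum sum_distrib_right flip: sum_divide_distrib)
  also have "\<dots> = (\<Sum>x\<in>UNIV. \<Sum>j\<in>P. \<Sum>y\<in>UNIV. (u j $ y - u j $ x)\<^sup>2 / c j)"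
    by (rule sum.swap)
  also have "\<dots> = (\<Sum>x\<in>UNIV. \<Sum>y\<in>UNIV. \<Sum>j\<in>P. (u j $ y - u j $ x)\<^sup>2 / c j)"
    by (intro sum.cong sum.swap refl)
  also have "\<dots> \<le> (\<Sum>x\<in>(UNIV :: 'v set). \<Sum>y\<in>UNIV. real (graph_dist E x y))"
    by (intro sum_mono effective_resistance_le)
  also have "\<dots> \<le> (\<Sum>x\<in>(UNIV :: 'v set). N * N / 2)"
  proof (rule sum_mono)
    fix x :: 'v
    have "2 * (\<Sum>y\<in>UNIV. graph_dist E x y) \<le> CARD('v) * CARD('v)"
      using sum_graph_dist_le[OF E(2), of x] by (meson diff_le_self le_trans mult_le_mono2)
    then have "real (2 * (\<Sum>y\<in>UNIV. graph_dist E x y)) \<le> real (CARD('v) * CARD('v))"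
      by (rule of_nat_mono)
    then show "(\<Sum>y\<in>UNIV. real (graph_dist E x y)) \<le> N * N / 2"
      by (simp add: N_def)
  qed
  also have "\<dots> = N\<^sup>2 / 4 * (2 * N)"
    by (simp add: N_def power2_eq_square)
  finally show ?thesis
    using N by (simp add: P_def N_def)
qed

text \<open>An eigenvector with \<open>c j \<le> 0\<close> has zero energy, so connectedness makes
  it constant; two nonzero constant vectors are never orthogonal.\<close>

lemma card_nonpos_eigenvalues_le:
  fixes E :: "'v::finite rel" and u :: "'v \<Rightarrow> real ^ 'v"
  assumes E: "simple_graph E" "connected_graph E"
    and u: "\<And>i j. u i \<bullet> u j = (if i = j then 1 else 0)"
    and eig: "\<And>i. laplacian E *v u i = c i *\<^sub>R u i"
  shows "card {j. c j \<le> 0} \<le> 1"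
proof -
  have const: "u j $ y = u j $ x" if "c j \<le> 0" for j x y
  proof -
    have "dirichlet_energy E (u j) = c j"
      by (simp add: eig u flip: inner_laplacian[OF E(1)])
    then have "dirichlet_energy E (u j) = 0"
      using dirichlet_energy_nonneg[of E "u j"] that by simp
    then show ?thesis
      using difference_sq_le_energy[OF E, of "u j" y x] by simp
  qed
  have "i = j" if "c i \<le> 0" "c j \<le> 0" for i j
  proof (rule ccontr)
    assume "i \<noteq> j"
    fix x :: 'v
    have inner: "u k \<bullet> u l = real CARD('v) * (u k $ x * u l $ x)" if "c k \<le> 0" "c l \<le> 0" for k l
    proof -
      have eq: "u k $ y * u l $ y = u k $ x * u l $ x" for y
        using const[OF that(1), of y x] const[OF that(2), of y x] by simp
      have "u k \<bullet> u l = (\<Sum>y\<in>(UNIV :: 'v set). u k $ x * u l $ x)"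
        unfolding inner_vec_def inner_real_def by (intro sum.cong refl eq)
      then show ?thesis
        by simp
    qed
    show False
      using u[of i j] u[of i i] u[of j j] \<open>i \<noteq> j\<close> inner that by auto
  qed
  then show ?thesis
    by (simp add: card_le_Suc0_iff_eq)
qed

text \<open>\<open>mat 1 - rrw_matrix E\<close> is the Laplacian over \<open>max_degree E\<close>,
  so the trace of the exponential is a sum of exponentials of eigenvalues. The summand 1 accounts
  for the eigenvalue 0, and \<open>I\<close> holds the positive ones. From here on only these
  numbers matter.\<close>

lemma average_return_prob_le_eigenvalue_sum:
  fixes E :: "'v::finite rel"
  assumes E: "simple_graph E" "connected_graph E" and deg: "max_degree E > 0"
  obtains I :: "'v set" and c :: "'v \<Rightarrow> real"
  where "\<And>j. j \<in> I \<Longrightarrow> 0 < c j" and "(\<Sum>j\<in>I. 1 / c j) \<le> (real CARD('v))\<^sup>2 / 4"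
    and "\<And>t. average_return_prob E t
      \<le> (1 + (\<Sum>j\<in>I. exp (- (t / real (max_degree E) * c j)))) / real CARD('v)"
proof -
  obtain u :: "'v \<Rightarrow> real ^ 'v" and c
    where u: "\<And>i j. u i \<bullet> u j = (if i = j then 1 else 0)"
      and eig: "\<And>i. laplacian E *v u i = c i *\<^sub>R u i"
    using symmetric_matrix_orthonormal_eigenbasis[OF transpose_laplacian[OF E(1)]] by blast
  define I where "I = {j. 0 < c j}"
  have bound: "average_return_prob E t
      \<le> (1 + (\<Sum>j\<in>I. exp (- (t / real (max_degree E) * c j)))) / real CARD('v)" for t
  proof -
    define r where "r = t / real (max_degree E)"
    define M where "M = - t *\<^sub>R (mat 1 - rrw_matrix E)"
    have "M = - r *\<^sub>R laplacian E"
      using deg by (simp add: M_def r_def rrw_matrix_def laplacian_def algebra_simps)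
    then have M: "M *v u j = - (r * c j) *\<^sub>R u j" for j
      by (simp only: eig scaleR_scaleR mult_minus_left flip: scaleR_matrix_vector_assoc)
    have nonneg: "0 \<le> c j" for j
      using dirichlet_energy_nonneg[of E "u j"] by (simp add: eig u flip: inner_laplacian[OF E(1)])
    have "average_return_prob E t * real CARD('v) = trace (matrix_exp M)"
      by (simp add: average_return_prob_def rrw_prob_def trace_def M_def)
    also have "\<dots> = (\<Sum>j\<in>UNIV. exp (- (r * c j)))"
      by (simp add: trace_orthonormal_basis[OF u] matrix_exp_eigenvector[OF M] u)
    also have "\<dots> = (\<Sum>j\<in>I. exp (- (r * c j))) + (\<Sum>j | c j \<le> 0. exp (- (r * c j)))"
      unfolding I_def by (subst sum.union_disjoint[symmetric]) (auto intro: sum.cong)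
    also have "(\<Sum>j | c j \<le> 0. exp (- (r * c j))) = (\<Sum>j | c j \<le> 0. 1)"
      by (intro sum.cong refl) (use nonneg in \<open>auto simp: order.antisym\<close>)
    also have "\<dots> \<le> 1"
      using card_nonpos_eigenvalues_le[OF E u eig] by simp
    finally show ?thesis
      by (simp add: r_def field_simps)
  qed
  show ?thesis
  proof (rule that)
    show "(\<Sum>j\<in>I. 1 / c j) \<le> (real CARD('v))\<^sup>2 / 4"
      unfolding I_def by (rule sum_inverse_eigenvalues_le[OF E u eig])
  qed (use bound in \<open>auto simp: I_def\<close>)
qed

section \<open>Exponential sums controlled by sums of reciprocals\<close>

text \<open>Splitting off \<open>exp (- s)\<close> keeps the decay due to the spectral gap; the
  remaining \<open>exp (- (s * (x - 1)))\<close> is traded for a multiple of \<open>1 / x\<close>,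
  which can be summed.\<close>

lemma exp_neg_le_of_ge_1:
  fixes s x :: real
  assumes "0 < s" "1 \<le> x"
  shows "exp (- (s * x)) \<le> max 1 (1 / s) / x * exp (- s)"
proof -
  define r where "r = min s 1"
  have r: "0 < r" "r \<le> 1" "r \<le> s" "max 1 (1 / s) = 1 / r"
    using assms by (auto simp: r_def min_def max_def field_simps)
  have "r * x \<le> 1 + r * (x - 1)"
    using r by (simp add: algebra_simps)
  also have "\<dots> \<le> 1 + s * (x - 1)"
    using r assms by (simp add: mult_right_mono)
  also have "\<dots> \<le> exp (s * (x - 1))"
    by (rule exp_ge_add_one_self)
  finally have "exp (- (s * (x - 1))) \<le> 1 / (r * x)"
    using r assms by (simp add: exp_minus inverse_eq_divide frac_le)
  then have "exp (- (s * (x - 1))) * exp (- s) \<le> 1 / (r * x) * exp (- s)"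
    by (intro mult_right_mono) auto
  then show ?thesis
    using r by (simp add: algebra_simps flip: exp_add)
qed

text \<open>Every single reciprocal is at most \<open>K\<close>, which is the gap
  \<open>c j \<ge> 1 / K\<close>. The second bound uses the gap alone; the first takes
  \<open>s = r / K\<close> and \<open>x = K * c j\<close> in the previous lemma, where the
  \<open>1 / x\<close> sum to at most 1.\<close>

lemma sum_exp_neg_le:
  fixes c :: "'a \<Rightarrow> real"
  assumes "finite I" and pos: "\<And>j. j \<in> I \<Longrightarrow> 0 < c j" and sum: "(\<Sum>j\<in>I. 1 / c j) \<le> K"
    and "0 < K" "0 < r"
  shows "(\<Sum>j\<in>I. exp (- (r * c j))) \<le> max 1 (K / r) * exp (- (r / K))"
    and "(\<Sum>j\<in>I. exp (- (r * c j))) \<le> real (card I) * exp (- (r / K))"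
proof -
  have ge1: "1 \<le> K * c j" if "j \<in> I" for j
  proof -
    have "1 / c j \<le> (\<Sum>j\<in>I. 1 / c j)"
      using that pos \<open>finite I\<close> by (intro member_le_sum) (auto simp: less_imp_le)
    with sum have "1 / c j \<le> K"
      by linarith
    then show ?thesis
      using pos[OF that] by (simp add: field_simps)
  qed
  have "exp (- (r * c j)) \<le> max 1 (K / r) * exp (- (r / K)) / K * (1 / c j)" if "j \<in> I" for j
    using exp_neg_le_of_ge_1[of "r / K" "K * c j"] ge1[OF that] pos[OF that] \<open>0 < K\<close> \<open>0 < r\<close>
    by (simp add: algebra_simps)
  then have "(\<Sum>j\<in>I. exp (- (r * c j))) \<le> (\<Sum>j\<in>I. max 1 (K / r) * exp (- (r / K)) / K * (1 / c j))"
    by (rule sum_mono)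
  also have "\<dots> \<le> max 1 (K / r) * exp (- (r / K)) / K * K"
    unfolding sum_distrib_left[symmetric] using sum \<open>0 < K\<close> by (intro mult_left_mono) auto
  finally show "(\<Sum>j\<in>I. exp (- (r * c j))) \<le> max 1 (K / r) * exp (- (r / K))"
    using \<open>0 < K\<close> by simp
  have "exp (- (r * c j)) \<le> exp (- (r / K))" if "j \<in> I" for j
    using mult_left_mono[OF ge1[OF that], of "r / K"] \<open>0 < K\<close> \<open>0 < r\<close> by simp
  then show "(\<Sum>j\<in>I. exp (- (r * c j))) \<le> real (card I) * exp (- (r / K))"
    by (rule sum_bounded_above)
qed

section \<open>The return probability\<close>

lemma ln16_ge: "5 / 2 \<le> ln (16 :: real)"
proof -
  have "ln (16 :: real) = 4 * ln 2"
    using ln_realpow[of 2 4] by simp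
  then show ?thesis
    using ln2_ge_two_thirds by simp
qed

text \<open>
  The admissible times form a nonempty interval only if \<open>N\<close> is exponentially large in \<open>d\<close>.
\<close>
lemma sum_bound_in_time_window:
  fixes \<nu> d N t :: real
  assumes d: "3 \<le> d" and N: "1 \<le> N" and \<nu>: "\<nu> = 1 / ((d - 1) * ln 16)"
    and lo: "4 powr (1 + \<nu>) * N powr (1 - \<nu>) \<le> t"
    and hi: "t \<le> 4 powr (- ((1 + \<nu>)\<^sup>2 / \<nu>)) * N ^ 4"
  shows "max 1 (d * N\<^sup>2 / (4 * t)) \<le> (N powr (1 - \<nu>) / sqrt t) powr (1 / (1 + \<nu>)) * N
    \<or> N \<le> (N powr (1 - \<nu>) / sqrt t) powr (1 / (1 + \<nu>)) * N"
proof -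
  define Z where "Z = (N powr (1 - \<nu>) / sqrt t) powr (1 / (1 + \<nu>)) * N"
  have ln4: "1 \<le> ln (4 :: real)"
  proof -
    have "ln (4 :: real) = 2 * ln 2"
      using ln_realpow[of 2 2] by simp
    then show ?thesis
      using ln2_ge_two_thirds by simp
  qed
  have "5 \<le> (d - 1) * ln 16"
    using mult_mono[of 2 "d - 1" "5 / 2" "ln 16"] d ln16_ge by simp
  then have \<nu>_pos: "0 < \<nu>" and \<nu>_le: "\<nu> \<le> 1 / 5"
    unfolding \<nu> by (simp, intro frac_le) auto
  have inv_\<nu>: "5 / 2 * (d - 1) \<le> 1 / \<nu>"
    using mult_left_mono[OF ln16_ge, of "d - 1"] d by (simp add: \<nu> mult.commute)
  have "0 < 4 powr (1 + \<nu>) * N powr (1 - \<nu>)"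
    using N by simp
  with lo have t_pos: "0 < t"
    by (rule less_le_trans[rotated])
  \<comment> \<open>In the logarithms \<open>n\<close>, \<open>\<tau>\<close> and \<open>z\<close>
    of \<open>N\<close>, \<open>t\<close> and \<open>Z\<close> the time window becomes a pair of
    linear inequalities in \<open>n\<close> and \<open>\<tau>\<close>.\<close>
  define n where "n = ln N"
  define \<tau> where "\<tau> = ln t"
  have n0: "0 \<le> n"
    using N by (simp add: n_def)
  have Nexp: "N = exp n" and texp: "t = exp \<tau>"
    using N t_pos by (simp_all add: n_def \<tau>_def)
  have lo': "(1 + \<nu>) * ln 4 + (1 - \<nu>) * n \<le> \<tau>"
  proof -
    have "exp ((1 + \<nu>) * ln 4 + (1 - \<nu>) * n) \<le> exp \<tau>"
      using lo by (simp add: Nexp texp powr_def exp_add)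
    then show ?thesis
      unfolding exp_le_cancel_iff .
  qed
  have hi': "\<tau> + (1 + \<nu>)\<^sup>2 / \<nu> * ln 4 \<le> 4 * n"
  proof -
    have "exp \<tau> \<le> exp (- ((1 + \<nu>)\<^sup>2 / \<nu> * ln 4)) * exp (4 * n)"
      using hi by (simp add: Nexp texp powr_def flip: exp_of_nat_mult)
    then show ?thesis
      unfolding exp_add[symmetric] exp_le_cancel_iff by simp
  qed
  define z where "z = ((1 - \<nu>) * n - \<tau> / 2) / (1 + \<nu>) + n"
  have Z: "Z = exp z"
  proof -
    have "sqrt t = exp (\<tau> / 2)"
      by (intro real_sqrt_unique) (simp_all add: texp flip: exp_of_nat_mult)
    then have "N powr (1 - \<nu>) / sqrt t = exp ((1 - \<nu>) * n - \<tau> / 2)"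
      by (simp add: Nexp powr_def exp_diff)
    then show ?thesis
      unfolding Z_def by (simp add: powr_def z_def Nexp exp_add)
  qed
  have z: "(1 + \<nu>) * z = 2 * n - \<tau> / 2"
    using \<nu>_pos by (simp add: z_def field_simps)
  have quot: "(1 + \<nu>)\<^sup>2 / \<nu> = 1 / \<nu> + 2 + \<nu>"
    using \<nu>_pos by (simp add: power2_eq_square field_simps)
  have "1 / \<nu> * 1 \<le> 1 / \<nu> * ln 4"
    using ln4 \<nu>_pos by (intro mult_left_mono) auto
  then have inv_\<nu>': "5 / 2 * (d - 1) \<le> 1 / \<nu> * ln 4"
    using inv_\<nu> by linarith
  show ?thesis
    unfolding Z_def[symmetric] Z
  \<comment> \<open>The case \<open>n \<le> z\<close> is the second alternative; otherwise
    \<open>z < n\<close> helps to prove the first.\<close>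
  proof (cases "n \<le> z")
    case True
    then have "N \<le> exp z"
      by (simp add: Nexp)
    then show "max 1 (d * N\<^sup>2 / (4 * t)) \<le> exp z \<or> N \<le> exp z"
      by (rule disjI2)
  next
    case False
    \<comment> \<open>The upper end of the window is used here: its exponent gives
      \<open>(1 + \<nu>) / \<nu> * ln 4 \<le> 2 * z\<close>, which is linear in
      \<open>d\<close>.\<close>
    have z_ge: "5 / 4 * (d - 1) \<le> z"
    proof -
      have "(1 + \<nu>) * (1 + \<nu>) / \<nu> * ln 4 \<le> 2 * ((1 + \<nu>) * z)"
        using hi' z by (simp add: power2_eq_square)
      then have "(1 + \<nu>) * ((1 + \<nu>) / \<nu> * ln 4) \<le> (1 + \<nu>) * (2 * z)"
        by (simp add: algebra_simps)
      then have "(1 + \<nu>) / \<nu> * ln 4 \<le> 2 * z"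
        by (rule mult_left_le_imp_le) (use \<nu>_pos in simp)
      moreover have "(1 + \<nu>) / \<nu> * ln 4 = 1 / \<nu> * ln 4 + ln 4"
        using \<nu>_pos by (simp add: field_simps)
      ultimately show ?thesis
        using inv_\<nu>' ln4 by linarith
    qed
    have d_le: "d / 4 \<le> exp ((d - 1) / 4)"
      using exp_ge_add_one_self[of "(d - 1) / 4"] d by (simp add: field_simps)
    \<comment> \<open>The left-hand side is \<open>d * N\<^sup>2 / (4 * t)\<close>. For
      \<open>t \<ge> N\<^sup>2\<close> the exponential is at most 1, and the factor
      \<open>d / 4\<close> is absorbed by \<open>z_ge\<close>.\<close>
    have "d / 4 * exp (2 * n - \<tau>) \<le> exp z"
    proof (cases "2 * n \<le> \<tau>")
      case True
      have "d / 4 * exp (2 * n - \<tau>) \<le> exp ((d - 1) / 4) * 1"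
        using True d_le d by (intro mult_mono) auto
      also have "\<dots> \<le> exp z"
        using z_ge d by simp
      finally show ?thesis .
    next
      case False
      \<comment> \<open>Chaining both ends of the window bounds \<open>n\<close> below. With
        \<open>2 * n - \<tau> < 2 * \<nu> * n\<close> and \<open>(1 - \<nu>) * n \<le> z\<close> it
        remains to see \<open>(d - 1) / 4 \<le> (1 - 3 * \<nu>) * n\<close>; here
        \<open>\<nu> \<le> 1 / 5\<close> leaves \<open>2 / 5 * n\<close>, and
        \<open>n \<ge> 5 / 8 * (d - 1)\<close> suffices exactly.\<close>
      have n_ge: "5 / 2 * (d - 1) \<le> 4 * n"
      proof -
        have "(1 + \<nu>) * ln 4 + (1 - \<nu>) * n + (1 / \<nu> + 2 + \<nu>) * ln 4 \<le> 4 * n"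
          using lo' hi' quot by simp
        moreover have "0 \<le> \<nu> * ln 4" "0 \<le> (1 - \<nu>) * n"
          using \<nu>_pos \<nu>_le n0 ln4 by simp_all
        ultimately show ?thesis
          using inv_\<nu>' ln4 unfolding distrib_right by linarith
      qed
      have "2 * n - \<tau> < 2 * \<nu> * n"
      proof -
        have "(1 + \<nu>) * z < (1 + \<nu>) * n"
          using \<open>\<not> n \<le> z\<close> \<nu>_pos by (intro mult_strict_left_mono) auto
        then show ?thesis
          using z by (simp add: algebra_simps)
      qed
      moreover have "(1 - \<nu>) * n \<le> z"
      proof -
        have "(1 + \<nu>) * ((1 - \<nu>) * n) = n - \<nu>\<^sup>2 * n"
          by (simp add: algebra_simps power2_eq_square)
        also have "\<dots> \<le> n"
          using n0 by simp
        also have "\<dots> \<le> (1 + \<nu>) * z"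
          using z False by simp
        finally show ?thesis
          by (rule mult_left_le_imp_le) (use \<nu>_pos in simp)
      qed
      moreover have "\<nu> * n \<le> 1 / 5 * n"
        using \<nu>_le n0 by (intro mult_right_mono) auto
      ultimately have "(d - 1) / 4 + (2 * n - \<tau>) \<le> z"
        using n_ge unfolding left_diff_distrib by linarith
      then have "exp ((d - 1) / 4) * exp (2 * n - \<tau>) \<le> exp z"
        by (simp flip: exp_add)
      moreover have "d / 4 * exp (2 * n - \<tau>) \<le> exp ((d - 1) / 4) * exp (2 * n - \<tau>)"
        using d_le by (intro mult_right_mono) auto
      ultimately show ?thesis
        by linarith
    qed
    moreover have "d * N\<^sup>2 / (4 * t) = d / 4 * exp (2 * n - \<tau>)"
      by (simp add: Nexp texp exp_diff flip: exp_of_nat_mult)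
    moreover have "1 \<le> exp z"
      using z_ge d by simp
    ultimately have "max 1 (d * N\<^sup>2 / (4 * t)) \<le> exp z"
      by (simp only: max.bounded_iff)
    then show "max 1 (d * N\<^sup>2 / (4 * t)) \<le> exp z \<or> N \<le> exp z" ..
  qed
qed

theorem theorem1p10:
  fixes E :: "'v::finite rel"
    and N \<delta> :: nat
    and \<nu> a t_lo t_hi t :: real
  assumes "simple_graph E" and "connected_graph E"
    and "N = CARD('v)"
    and "\<delta> = max_degree E" and "\<delta> \<ge> 3"
    and "\<nu> = 1 / ((real \<delta> - 1) * ln 16)"
    and "a = 1 + sqrt (pi * real \<delta>) / 2 powr (1 - \<nu>)"
    and "t_lo = 4 powr (1 + \<nu>) * real N powr (1 - \<nu>)"
    and "t_hi = 4 powr (- ((1 + \<nu>)\<^sup>2 / \<nu>)) * real N ^ 4"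
    and "t \<in> {t_lo..t_hi}"
  shows "average_return_prob E t \<le>
    1 / real N + a * (real N powr (1 - \<nu>) / sqrt t) powr (1 / (1 + \<nu>))
      * exp (- (4 * t / (real \<delta> * (real N)\<^sup>2)))"
proof -
  define X where "X = (real N powr (1 - \<nu>) / sqrt t) powr (1 / (1 + \<nu>))"
  define e where "e = exp (- (4 * t / (real \<delta> * (real N)\<^sup>2)))"
  have N: "1 \<le> real N"
    using assms(3) by (simp add: Suc_le_eq)
  have "0 < t_lo"
    using N by (simp add: assms(8))
  then have t: "0 < t"
    using assms(10) by simp
  obtain I :: "'v set" and c
    where I: "\<And>j. j \<in> I \<Longrightarrow> 0 < c j" "(\<Sum>j\<in>I. 1 / c j) \<le> (real N)\<^sup>2 / 4"
      and P: "average_return_prob E t \<le> (1 + (\<Sum>j\<in>I. exp (- (t / real \<delta> * c j)))) / real N"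
    using average_return_prob_le_eigenvalue_sum[OF assms(1,2)] assms(5)
    unfolding assms(3,4) by (metis less_le_trans zero_less_numeral)
  have K: "0 < (real N)\<^sup>2 / 4" "0 < t / real \<delta>"
    using N t assms(5) by simp_all
  have e_eq: "t / real \<delta> / ((real N)\<^sup>2 / 4) = 4 * t / (real \<delta> * (real N)\<^sup>2)"
      "(real N)\<^sup>2 / 4 / (t / real \<delta>) = real \<delta> * (real N)\<^sup>2 / (4 * t)"
    by simp_all
  have "real (card I) \<le> real N"
    unfolding assms(3) by (simp add: card_mono)
  then have card_bound: "real (card I) * e \<le> real N * e"
    by (intro mult_right_mono) (simp_all add: e_def)
  \<comment> \<open>Each alternative of the window lemma is matched with the corresponding bound of
    \<open>sum_exp_neg_le\<close>, for \<open>K = N\<^sup>2 / 4\<close> and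
    \<open>r = t / \<delta>\<close>; \<open>e\<close> is the common decay factor.\<close>
  have "(\<Sum>j\<in>I. exp (- (t / real \<delta> * c j))) \<le> X * real N * e"
    using sum_bound_in_time_window[of "real \<delta>" "real N" \<nu> t]
  proof (rule disjE)
    assume "max 1 (real \<delta> * (real N)\<^sup>2 / (4 * t)) \<le> (real N powr (1 - \<nu>) / sqrt t) powr (1 / (1 + \<nu>)) * real N"
    then have "max 1 (real \<delta> * (real N)\<^sup>2 / (4 * t)) * e \<le> X * real N * e"
      unfolding X_def by (intro mult_right_mono) (simp_all add: e_def)
    with sum_exp_neg_le(1)[OF finite I K, unfolded e_eq, folded e_def] show ?thesis
      by (rule order_trans)
  next
    assume "real N \<le> (real N powr (1 - \<nu>) / sqrt t) powr (1 / (1 + \<nu>)) * real N"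
    then have "real N * e \<le> X * real N * e"
      unfolding X_def by (intro mult_right_mono) (simp_all add: e_def)
    with card_bound have "real (card I) * e \<le> X * real N * e"
      by (rule order_trans)
    with sum_exp_neg_le(2)[OF finite I K, unfolded e_eq, folded e_def] show ?thesis
      by (rule order_trans)
  qed (use assms N in auto)
  then have "(1 + (\<Sum>j\<in>I. exp (- (t / real \<delta> * c j)))) / real N \<le> (1 + X * real N * e) / real N"
    by (intro divide_right_mono) auto
  with P have "average_return_prob E t \<le> (1 + X * real N * e) / real N"
    by (rule order_trans)
  also have "\<dots> = 1 / real N + 1 * X * e"
    using N by (simp add: field_simps)
  also have "\<dots> \<le> 1 / real N + a * X * e"
    unfolding assms(7) by (intro add_left_mono mult_right_mono) (auto simp: X_def e_def)
  finally show ?thesis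
    by (simp add: X_def e_def)
qed

end
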